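(* Let $(X,d)$ be a metric space, $f:X\to\mathbb R\cup\{+\infty\}$ a function with $F:=\mathrm{zer}\,f:=\{x\in X: f(x)=0\}\neq\emptyset$, let $z\in\mathrm{zer}\,f$ and $b>0$, and let $\mu:\mathbb N\to\mathbb N$ be a modulus of regularity for $f$ with respect to $\mathrm{zer}\,f$ and $\overline B(z,b)$. Let $S(n,k)$ be a property of pairs $(n,k)\in\mathbb N^2$ that is monotone in $k$, and let $G,H:[0,\infty)\to[0,\infty)$ be functions with moduli $\alpha_G,\beta_H$. Let $(x_n)$ be a sequence in $\overline B(z,b)$ which is uniformly locally $S$-relativized $(G,H)$-Fejér monotone w.r.t. $F$ with modulus $\rho:\mathbb N\to\mathbb N$, and let $\Phi:\mathbb N\to\mathbb N$ be an approximate $F/S$-bound for $(x_n)$. Define $$\Psi(k):=\Phi\Big(\max\big\{\rho(2\beta_H(k)+1),\ \mu\big(\max\{\alpha_G(2\beta_H(k)+1),\rho(2\beta_H(k)+1)\}\big)\big\}\Big).$$ Then: (1) $(x_n)$ is a Cauchy sequence with rate $\Psi(2k+1)$, i.e. for all $k,m,\tilde m\in\mathbb N$ with $m,\tilde m\ge\Psi(2k+1)$ one has $d(x_m,x_{\tilde m})\le\frac1{k+1}$; (2) for all $k\in\mathbb N$ and all $n\ge\Psi(k)$, $\mathrm{dist}(x_n,\mathrm{zer}\,f)\le\frac1{k+1}$; (3) if moreover $X$ is complete and $\mathrm{zer}\,f$ is closed, then $(x_n)$ converges to a zero $z'$ of $f$ with rate of convergence $\Psi(2k+1)$, i.e. $d(x_m,z')\le\frac1{k+1}$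 for all $k\in\mathbb N$ and $m\ge\Psi(2k+1)$.
   Context: $\mathbb N=\{0,1,2,\dots\}$. $\overline B(z,b)$ is the closed ball and $\mathrm{dist}(x,A)=\inf_{a\in A}d(x,a)$. Modulus of regularity: $\mu:\mathbb N\to\mathbb N$ is a modulus of regularity for $f$ w.r.t. $\mathrm{zer}\,f$ and $\overline B(z,b)$ if for all $k\in\mathbb N$ and $x\in\overline B(z,b)$: $|f(x)|<\frac1{\mu(k)+1}$ implies $\mathrm{dist}(x,\mathrm{zer}\,f)<\frac1{k+1}$. Monotonicity of $S$: for all $n,k_1,k_2\in\mathbb N$, if $k_1\le k_2$ and $S(n,k_2)$, then $S(n,k_1)$. Approximate $F/S$-bound: $\Phi:\mathbb N\to\mathbb N$ (assumed nondecreasing) such that for every $k\in\mathbb N$ there is $n\le\Phi(k)$ with $|f(x_n)|<\frac1{k+1}$ and $S(n,k)$. Moduli of $G,H$: $\alpha_G,\beta_H:\mathbb N\to\mathbb N$ are such that for all $k\in\mathbb N$ and $a\in[0,\infty)$: $a\le\frac1{\alpha_G(k)+1}$ implies $G(a)\le\frac1{k+1}$, and $H(a)\le\frac1{\beta_H(k)+1}$ implies $a\le\frac1{k+1}$. Uniformly locally $S$-relativized $(G,H)$-Fejér monotone w.r.t. $F$ with modulus $\rho$: for all $p\in F$ and $r,n\in\mathbb N$: if $d(x_n,p)<\frac1{\rho(r)+1}$ and $S(n,\rho(r))$, then $H(d(x_{n+l},p))\le G(d(x_n,p))+\frac1{r+1}$ for all $l\in\mathbb N$. *)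

theory Defs
  imports "HOL-Analysis.Analysis"
begin

text \<open>The codomain \<open>\<real> \<union> {+\<infinity>}\<close> of \<open>f\<close> is rendered by extended reals; the value \<open>-\<infinity>\<close> is
  excluded by a hypothesis where \<open>f\<close> is introduced. Functions on \<open>[0,\<infinity>)\<close> are functions on the
  reals of which only the values at nonnegative arguments are used.\<close>

definition zer :: "('a \<Rightarrow> ereal) \<Rightarrow> 'a set" where
  "zer f = {x. f x = 0}"

definition regularity_modulus ::
  "(nat \<Rightarrow> nat) \<Rightarrow> ('a::metric_space \<Rightarrow> ereal) \<Rightarrow> 'a \<Rightarrow> real \<Rightarrow> bool" where
  "regularity_modulus \<mu> f z b \<longleftrightarrow>
     (\<forall>k. \<forall>x\<in>cball z b. \<bar>f x\<bar> < ereal (1 / (real (\<mu> k) + 1))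
        \<longrightarrow> infdist x (zer f) < 1 / (real k + 1))"

definition monotone_relativizer :: "(nat \<Rightarrow> nat \<Rightarrow> bool) \<Rightarrow> bool" where
  "monotone_relativizer S \<longleftrightarrow> (\<forall>n k1 k2. k1 \<le> k2 \<and> S n k2 \<longrightarrow> S n k1)"

definition approximate_FS_bound ::
  "(nat \<Rightarrow> nat) \<Rightarrow> ('a \<Rightarrow> ereal) \<Rightarrow> (nat \<Rightarrow> nat \<Rightarrow> bool) \<Rightarrow> (nat \<Rightarrow> 'a) \<Rightarrow> bool" where
  "approximate_FS_bound \<Phi> f S x \<longleftrightarrow>
     mono \<Phi> \<and> (\<forall>k. \<exists>n\<le>\<Phi> k. \<bar>f (x n)\<bar> < ereal (1 / (real k + 1)) \<and> S n k)"

definition G_modulus :: "(nat \<Rightarrow> nat) \<Rightarrow> (real \<Rightarrow> real) \<Rightarrow> bool" where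
  "G_modulus \<alpha> G \<longleftrightarrow>
     (\<forall>k. \<forall>a\<ge>0. a \<le> 1 / (real (\<alpha> k) + 1) \<longrightarrow> G a \<le> 1 / (real k + 1))"

definition H_modulus :: "(nat \<Rightarrow> nat) \<Rightarrow> (real \<Rightarrow> real) \<Rightarrow> bool" where
  "H_modulus \<beta> H \<longleftrightarrow>
     (\<forall>k. \<forall>a\<ge>0. H a \<le> 1 / (real (\<beta> k) + 1) \<longrightarrow> a \<le> 1 / (real k + 1))"

definition locally_relativized_Fejer_monotone ::
  "(nat \<Rightarrow> nat) \<Rightarrow> (nat \<Rightarrow> nat \<Rightarrow> bool) \<Rightarrow> (real \<Rightarrow> real) \<Rightarrow> (real \<Rightarrow> real)
     \<Rightarrow> 'a::metric_space set \<Rightarrow> (nat \<Rightarrow> 'a) \<Rightarrow> bool" where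
  "locally_relativized_Fejer_monotone \<rho> S G H F x \<longleftrightarrow>
     (\<forall>p\<in>F. \<forall>r n. dist (x n) p < 1 / (real (\<rho> r) + 1) \<and> S n (\<rho> r)
        \<longrightarrow> (\<forall>l. H (dist (x (n + l)) p) \<le> G (dist (x n) p) + 1 / (real r + 1)))"

definition Psi ::
  "(nat \<Rightarrow> nat) \<Rightarrow> (nat \<Rightarrow> nat) \<Rightarrow> (nat \<Rightarrow> nat) \<Rightarrow> (nat \<Rightarrow> nat) \<Rightarrow> (nat \<Rightarrow> nat) \<Rightarrow> nat \<Rightarrow> nat" where
  "Psi \<Phi> \<rho> \<mu> \<alpha> \<beta> k =
     \<Phi> (max (\<rho> (2 * \<beta> k + 1))
            (\<mu> (max (\<alpha> (2 * \<beta> k + 1)) (\<rho> (2 * \<beta> k + 1)))))"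

end

theory Submission
  imports Defs
begin

text \<open>At the index supplied by the approximate bound, regularity provides an exact zero \<open>p\<close> so close
  to the sequence that Fejer monotonicity, which is only available near zeros of \<open>f\<close>, applies to it;
  from then on the sequence stays within \<open>1/(k+1)\<close> of that single \<open>p\<close>. All three claims follow
  from this by the triangle inequality.\<close>

text \<open>The infimum need not be attained, so the strict bound is what leaves room for an actual
  point. Nonemptiness matters because \<open>infdist\<close> to the empty set is 0 by
  convention.\<close>

lemma infdist_less_obtain:
  assumes "A \<noteq> {}" "infdist x A < e"
  obtains a where "a \<in> A" "dist x a < e"
  using assms cInf_less_iff[of "dist x ` A" e] bdd_below_image_dist[of x A]
  by (auto simp: infdist_def)

lemma inverse_Suc_mono:
  assumes "m \<le> n"
  shows "1 / (real n + 1) \<le> 1 / (real m + 1)"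
  using assms by (simp add: frac_le)

lemma double_half_rate: "2 * (1 / (real (2 * k + 1) + 1)) = 1 / (real k + 1)"
  by (simp add: field_simps)

lemma eventually_near_one_zero:
  assumes "zer f \<noteq> {}" and reg: "regularity_modulus \<mu> f z b"
    and S: "monotone_relativizer S" and G: "G_modulus \<alpha> G" and H: "H_modulus \<beta> H"
    and ball: "\<And>n. x n \<in> cball z b"
    and fejer: "locally_relativized_Fejer_monotone \<rho> S G H (zer f) x"
    and bound: "approximate_FS_bound \<Phi> f S x"
  obtains p where "p \<in> zer f" "\<And>m. m \<ge> Psi \<Phi> \<rho> \<mu> \<alpha> \<beta> k \<Longrightarrow> dist (x m) p \<le> 1 / (real k + 1)"
proof -
  \<comment> \<open>With this choice \<open>1 / (r + 1)\<close> is exactly half of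
    \<open>1 / (\<beta> k + 1)\<close>: one half pays for the \<open>G\<close> term, the other for
    the Fejer error.\<close>
  define r where "r = 2 * \<beta> k + 1"
  \<comment> \<open>A zero within \<open>1 / (M + 1)\<close> is close enough both to make the
    \<open>G\<close> term small and to meet the locality condition of Fejer monotonicity.\<close>
  define M where "M = max (\<alpha> r) (\<rho> r)"
  \<comment> \<open>The part \<open>\<rho> r\<close> lets \<open>S n K\<close> descend to
    \<open>S n (\<rho> r)\<close>; the part \<open>\<mu> M\<close> makes \<open>f (x n)\<close>
    small enough for regularity at precision \<open>M\<close>.\<close>
  define K where "K = max (\<rho> r) (\<mu> M)"
  have Psi: "Psi \<Phi> \<rho> \<mu> \<alpha> \<beta> k = \<Phi> K"
    by (simp add: Psi_def r_def M_def K_def)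
  obtain n where n: "n \<le> \<Phi> K" "\<bar>f (x n)\<bar> < ereal (1 / (real K + 1))" "S n K"
    using bound unfolding approximate_FS_bound_def by blast
  have Sn: "S n (\<rho> r)"
    using S n(3) unfolding monotone_relativizer_def K_def by (meson max.cobounded1)
  have "1 / (real K + 1) \<le> 1 / (real (\<mu> M) + 1)"
    by (rule inverse_Suc_mono) (simp add: K_def)
  with n(2) have "\<bar>f (x n)\<bar> < ereal (1 / (real (\<mu> M) + 1))"
    by (meson ereal_less_eq(3) less_le_trans)
  with reg ball have "infdist (x n) (zer f) < 1 / (real M + 1)"
    unfolding regularity_modulus_def by blast
  then obtain p where p: "p \<in> zer f" "dist (x n) p < 1 / (real M + 1)"
    using infdist_less_obtain \<open>zer f \<noteq> {}\<close> by blast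
  have near: "dist (x n) p < 1 / (real (\<rho> r) + 1)" "dist (x n) p \<le> 1 / (real (\<alpha> r) + 1)"
    using p(2) inverse_Suc_mono[of "\<rho> r" M] inverse_Suc_mono[of "\<alpha> r" M] by (auto simp: M_def)
  have "G (dist (x n) p) \<le> 1 / (real r + 1)"
    using G near(2) unfolding G_modulus_def by simp
  moreover have "H (dist (x (n + l)) p) \<le> G (dist (x n) p) + 1 / (real r + 1)" for l
    using fejer p(1) near(1) Sn unfolding locally_relativized_Fejer_monotone_def by blast
  ultimately have "H (dist (x (n + l)) p) \<le> 1 / (real (\<beta> k) + 1)" for l
    using double_half_rate[of "\<beta> k"] unfolding r_def by (smt (verit))
  then have "dist (x (n + l)) p \<le> 1 / (real k + 1)" for l
    using H unfolding H_modulus_def by simp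
  \<comment> \<open>The index \<open>n\<close> is known only up to the bound
    \<open>\<Phi> K\<close>, but that suffices: every \<open>m\<close> beyond the bound has the form
    \<open>n + l\<close>.\<close>
  then show thesis
    using that p(1) n(1) Psi by (metis le_add_diff_inverse le_trans)
qed

lemma Cauchy_rate_imp_Cauchy:
  fixes x :: "nat \<Rightarrow> 'a::metric_space"
  assumes "\<And>k m n. N k \<le> m \<Longrightarrow> N k \<le> n \<Longrightarrow> dist (x m) (x n) \<le> 1 / (real k + 1)"
  shows "Cauchy x"
proof (rule metric_CauchyI)
  fix e :: real assume "e > 0"
  then obtain k where "1 / (real k + 1) < e"
    using nat_approx_posE by (metis of_nat_Suc add.commute)
  with assms[of k] show "\<exists>M. \<forall>m\<ge>M. \<forall>n\<ge>M. dist (x m) (x n) < e"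
    by (meson le_less_trans)
qed

theorem theorem3p4:
  fixes f :: "'a::metric_space \<Rightarrow> ereal"
    and z :: 'a and b :: real
    and x :: "nat \<Rightarrow> 'a"
    and S :: "nat \<Rightarrow> nat \<Rightarrow> bool"
    and G H :: "real \<Rightarrow> real"
    and \<mu> \<alpha>\<^sub>G \<beta>\<^sub>H \<rho> \<Phi> :: "nat \<Rightarrow> nat"
  assumes "\<And>y. f y \<noteq> -\<infinity>"
    and "zer f \<noteq> {}"
    and "z \<in> zer f"
    and "b > 0"
    and "regularity_modulus \<mu> f z b"
    and "monotone_relativizer S"
    and "\<And>a. a \<ge> 0 \<Longrightarrow> G a \<ge> 0"
    and "\<And>a. a \<ge> 0 \<Longrightarrow> H a \<ge> 0"
    and "G_modulus \<alpha>\<^sub>G G"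
    and "H_modulus \<beta>\<^sub>H H"
    and "\<And>n. x n \<in> cball z b"
    and "locally_relativized_Fejer_monotone \<rho> S G H (zer f) x"
    and "approximate_FS_bound \<Phi> f S x"
  defines "\<Psi> \<equiv> Psi \<Phi> \<rho> \<mu> \<alpha>\<^sub>G \<beta>\<^sub>H"
  shows "(Cauchy x \<and>
          (\<forall>k m m'. m \<ge> \<Psi> (2 * k + 1) \<and> m' \<ge> \<Psi> (2 * k + 1)
             \<longrightarrow> dist (x m) (x m') \<le> 1 / (real k + 1)))
       \<and> (\<forall>k. \<forall>n\<ge>\<Psi> k. infdist (x n) (zer f) \<le> 1 / (real k + 1))
       \<and> (complete (UNIV :: 'a set) \<and> closed (zer f) \<longrightarrow>
            (\<exists>z'\<in>zer f. x \<longlonglongrightarrow> z' \<and>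
               (\<forall>k. \<forall>m\<ge>\<Psi> (2 * k + 1). dist (x m) z' \<le> 1 / (real k + 1))))"
proof -
  \<comment> \<open>The zero depends on \<open>k\<close>, so it is not yet a candidate for the
    limit.\<close>
  have near: "\<exists>p\<in>zer f. \<forall>m\<ge>\<Psi> k. dist (x m) p \<le> 1 / (real k + 1)" for k
    using eventually_near_one_zero[OF assms(2,5,6,9-13), of k] unfolding \<Psi>_def by blast
  have rate: "dist (x m) (x m') \<le> 1 / (real k + 1)"
    if "\<Psi> (2 * k + 1) \<le> m" "\<Psi> (2 * k + 1) \<le> m'" for k m m'
  proof -
    \<comment> \<open>Precision \<open>2 * k + 1\<close> leaves each of the two points half of the
      allowed distance to a common zero.\<close>
    obtain p where "\<forall>m\<ge>\<Psi> (2 * k + 1). dist (x m) p \<le> 1 / (real (2 * k + 1) + 1)"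
      using near by blast
    with that have "dist (x m) p + dist (x m') p \<le> 2 * (1 / (real (2 * k + 1) + 1))"
      by (smt (verit))
    then show ?thesis
      using dist_triangle2[of "x m" "x m'" p] unfolding double_half_rate by linarith
  qed
  have Cauchy: "Cauchy x"
    using rate by (rule Cauchy_rate_imp_Cauchy)
  have dist_zer: "infdist (x n) (zer f) \<le> 1 / (real k + 1)" if "\<Psi> k \<le> n" for k n
    using near[of k] that by (meson infdist_le2)
  have "\<exists>z'\<in>zer f. x \<longlonglongrightarrow> z' \<and> (\<forall>k. \<forall>m\<ge>\<Psi> (2 * k + 1). dist (x m) z' \<le> 1 / (real k + 1))"
    if "complete (UNIV :: 'a set)" and "closed (zer f)"
  proof -
    obtain z' where lim: "x \<longlonglongrightarrow> z'"
      using \<open>complete UNIV\<close> Cauchy unfolding complete_def by auto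
    \<comment> \<open>Distance to a set is continuous, so the bound valid from
      \<open>\<Psi> k\<close> on passes to the limit.\<close>
    have "infdist z' (zer f) \<le> 1 / (real k + 1)" for k
      by (rule LIMSEQ_le_const2[OF tendsto_infdist[OF lim]]) (use dist_zer in blast)
    then have "infdist z' (zer f) \<le> 0"
      by (metis nat_approx_posE of_nat_Suc add.commute not_le)
    then have "z' \<in> zer f"
      using in_closed_iff_infdist_zero \<open>closed (zer f)\<close> \<open>zer f \<noteq> {}\<close> infdist_nonneg
      by (metis order_antisym)
    \<comment> \<open>Keeping \<open>m\<close> fixed and letting the other index of the Cauchy
      estimate tend to infinity preserves the rate unchanged.\<close>
    moreover have "dist (x m) z' \<le> 1 / (real k + 1)" if "\<Psi> (2 * k + 1) \<le> m" for k m
      by (rule LIMSEQ_le_const2[OF tendsto_dist[OF tendsto_const lim]]) (use rate that in blast)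
    ultimately show ?thesis
      using lim by (intro bexI[of _ z'] conjI) simp_all
  qed
  then show ?thesis
    using Cauchy rate dist_zer by (intro conjI allI impI) simp_all
qed

end
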